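(* Let $\{U_n,\mathcal{F}_n\}_{n\ge 1}$ be a sequence of real-valued bounded martingale differences (with $(\mathcal{F}_n)_{n\ge 0}$ a filtration and $U_n$ being $\mathcal{F}_n$-measurable for $n\ge1$), satisfying, for positive constants $K_u$ and $\sigma$ and all $n\ge 0$, $$\mathbb{E}[U_{n+1}\mid\mathcal{F}_n]=0,\qquad |U_{n+1}|\le K_u,\qquad \mathbb{E}[U_{n+1}^2\mid\mathcal{F}_n]=\sigma^2\ \text{ a.s.}$$ Let $(b_n)_{n\ge 1}$ be a sequence of positive numbers such that $b_n\to\infty$ and $b_n/\sqrt{n}\to 0$. Then for any constants $b$ and $\alpha_1$ satisfying $b\alpha_1<-1$, and for any $r>0$, $$\lim_{n\to\infty}\frac{1}{b_n^2}\log\mathbb{P}\left(h_n\left|b\sum_{k=0}^n\frac{1}{k+1}\beta_{k+1}^n(b\alpha_1)U_{k+1}\right|>r b_n\right)=-\frac{r^2}{2\sigma^2},$$ where $$\beta_k^n(b\alpha_1):=\prod_{j=k}^n\left(1+\frac{b\alpha_1}{j+1}\right),\qquad h_n:=\left(b^2\sum_{k=0}^n (k+1)^{-2}\left(\beta_{k+1}^n(b\alpha_1)\right)^2\right)^{-1/2}.$$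
   Context: The empty product equals $1$, i.e. $\beta_{n+1}^n(b\alpha_1)=1$. *)

theory Defs
  imports "HOL-Probability.Probability"
begin

(* c stands for the product b * alpha_1.
   For k = n + 1 the range k..n is empty and the product is 1. *)
definition beta_prod :: "real \<Rightarrow> nat \<Rightarrow> nat \<Rightarrow> real" where
  "beta_prod c k n = (\<Prod>j=k..n. 1 + c / (real j + 1))"

(* For b \<noteq> 0 the sum is positive, its k = n term being 1 / (n + 1)^2. *)
definition h_norm :: "real \<Rightarrow> real \<Rightarrow> nat \<Rightarrow> real" where
  "h_norm b \<alpha>\<^sub>1 n =
     (b\<^sup>2 * (\<Sum>k=0..n. 1 / (real k + 1)\<^sup>2 * (beta_prod (b * \<alpha>\<^sub>1) (k + 1) n)\<^sup>2)) powr (- 1 / 2)"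

(* Martingale differences U 1, U 2, ... for the filtration F 0, F 1, ... of M; the value U 0 is
   unconstrained. Integrability makes real_cond_exp the genuine conditional expectation. *)
definition martingale_differences ::
    "'a measure \<Rightarrow> (nat \<Rightarrow> 'a measure) \<Rightarrow> (nat \<Rightarrow> 'a \<Rightarrow> real) \<Rightarrow> bool" where
  "martingale_differences M F U \<longleftrightarrow>
     filtration (space M) F \<and>
     (\<forall>n. subalgebra M (F n)) \<and>
     (\<forall>n\<ge>1. U n \<in> borel_measurable (F n)) \<and>
     (\<forall>n\<ge>1. integrable M (U n)) \<and>
     (\<forall>n. AE x in M. real_cond_exp M (F n) (U (n + 1)) x = 0)"

end

theory Submission
  imports Defs
begin

text \<open>
  The sum in question is \<^term>\<open>S = (\<Sum>k\<le>n. w k * U (k + 1) x)\<close>, where the weights \<^term>\<open>w k\<close>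
  depend on \<^term>\<open>n\<close> and the factor \<^const>\<open>h_norm\<close> makes their squares add up to 1. The
  conditional variances being constant, the quadratic variation of \<^term>\<open>S\<close> is exactly
  \<open>\<sigma>\<^sup>2\<close>, so at the moderate level \<open>r b\<^sub>n\<close> the tail of \<^term>\<open>S\<close> should be Gaussian, of order
  \<open>exp (- r\<^sup>2 b\<^sub>n\<^sup>2 / (2 \<sigma>\<^sup>2))\<close>.

  Three ingredients turn this into a proof. First, no weight dominates: as \<open>b \<alpha>\<^sub>1 < - 1\<close>, the
  unnormalised weights are at most of order \<open>1 / n\<close> while the sum of their squares is at least of
  order \<open>1 / n\<close>, so that \<^term>\<open>\<bar>w k\<bar>\<close> is of order at most \<open>1 / sqrt n\<close>
  (\<open>normed_weight_bound\<close>). Second, the exponent \<open>t b\<^sub>n w k U (k + 1)\<close> is then uniformly small,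
  because \<open>b\<^sub>n / sqrt n\<close> tends to 0. Expanding the exponential to second order and conditioning on the
  past, one factor at a time, gives a moment generating function between
  \<open>exp (t\<^sup>2 b\<^sub>n\<^sup>2 \<sigma>\<^sup>2 (1 - o(1)) / 2)\<close> and \<open>exp (t\<^sup>2 b\<^sub>n\<^sup>2 \<sigma>\<^sup>2 (1 + o(1)) / 2)\<close>
  (\<open>exp_martingale_sum_ge\<close>, \<open>exp_martingale_sum_le\<close>). Third, a limiting logarithmic moment
  generating function that is quadratic forces Gaussian tails (\<open>gaussian_gaertner_ellis\<close>), the
  Gaussian case of the Gaertner-Ellis theorem.
\<close>

section \<open>Moment generating functions of weighted martingale sums\<close>

text \<open>
  The second-order Taylor remainder has a factor \<^term>\<open>exp t\<close> with \<^term>\<open>\<bar>t\<bar> \<le> d\<close>. Keeping it as a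
  factor of \<^term>\<open>x\<^sup>2 / 2\<close>, instead of an additive cubic error, makes the
  bounds exact multiples of the conditional variance after taking expectations.
\<close>
lemma exp_quadratic_bounds:
  fixes x d :: real
  assumes "\<bar>x\<bar> \<le> d"
  shows "1 + x + exp (- d) * x\<^sup>2 / 2 \<le> exp x" "exp x \<le> 1 + x + exp d * x\<^sup>2 / 2"
proof -
  obtain t where t: "\<bar>t\<bar> \<le> \<bar>x\<bar>" "exp x = (\<Sum>m<2. x ^ m / fact m) + exp t / fact 2 * x ^ 2"
    using Maclaurin_exp_le by blast
  have ex: "exp x = 1 + x + exp t * x\<^sup>2 / 2"
    using t(2) by (simp add: numeral_2_eq_2)
  have "exp (- d) * x\<^sup>2 \<le> exp t * x\<^sup>2" "exp t * x\<^sup>2 \<le> exp d * x\<^sup>2"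
    using t(1) assms by (auto intro!: mult_right_mono)
  then show "1 + x + exp (- d) * x\<^sup>2 / 2 \<le> exp x" "exp x \<le> 1 + x + exp d * x\<^sup>2 / 2"
    unfolding ex by auto
qed

text \<open>
  A converse, for small arguments, to \<^prop>\<open>1 + y \<le> exp y\<close>; it comes from
  \<^prop>\<open>y / (1 + y) \<le> ln (1 + y)\<close> and \<^prop>\<open>1 + y \<le> exp d\<close>.
\<close>
lemma exp_le_one_plus:
  fixes y d :: real
  assumes "0 \<le> y" "y \<le> d"
  shows "exp (exp (- d) * y) \<le> 1 + y"
proof -
  have "exp (- d) * y \<le> y / (1 + y)"
  proof -
    have "1 + y \<le> exp d" using assms exp_ge_add_one_self[of d] by linarith
    then have "exp (- d) \<le> 1 / (1 + y)"
      using assms by (simp add: exp_minus divide_simps)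
    then show ?thesis using mult_right_mono[of "exp (- d)" "1 / (1 + y)" y] assms by simp
  qed
  also have "\<dots> \<le> ln (1 + y)"
  proof -
    have "ln (1 / (1 + y)) \<le> 1 / (1 + y) - 1" using assms by (intro ln_le_minus_one) auto
    also have "\<dots> = - (y / (1 + y))" using assms by (simp add: field_simps)
    finally show ?thesis using assms by (simp add: ln_div)
  qed
  finally show ?thesis using assms by (simp add: ln_ge_iff)
qed

context prob_space
begin

lemma integral_mult_const_cond_exp:
  assumes "subalgebra M G" "Z \<in> borel_measurable G" "integrable M Z"
    and "integrable M X" "integrable M (\<lambda>x. Z x * X x)"
    and "AE x in M. real_cond_exp M G X x = c"
  shows "(\<integral>x. Z x * X x \<partial>M) = c * (\<integral>x. Z x \<partial>M)"
proof -
  interpret finite_measure_subalgebra M G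
    using assms(1) by unfold_locales
  have "(\<integral>x. Z x * X x \<partial>M) = (\<integral>x. Z x * real_cond_exp M G X x \<partial>M)"
    using assms by (intro real_cond_exp_intg(2)[symmetric]) auto
  also have "\<dots> = (\<integral>x. Z x * c \<partial>M)"
    using assms(6) by (intro integral_cong_AE) (use assms(3) in auto)
  finally show ?thesis by (simp add: mult.commute)
qed

text \<open>
  Both bounds go by induction on the number of summands. Let \<^term>\<open>Z\<close> be the exponential of the
  first \<^term>\<open>m\<close> summands. It is measurable with respect to \<^term>\<open>F m\<close>, so multiplying it by
  \<open>1 + x + e x\<^sup>2 / 2\<close>, where \<open>x = c m * U (m + 1)\<close>, multiplies its expectation by
  \<open>1 + e v (c m)\<^sup>2 / 2\<close>: the linear term vanishes and the conditional second moment is constant.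
  As \<open>\<bar>x\<bar> \<le> q K\<close>, the exponential of \<open>x\<close> lies between two such quadratics, with
  \<open>e = exp (- q K)\<close> and \<open>e = exp (q K)\<close>. For the lower bound, turning \<open>1 + y\<close> back into an
  exponential costs a further factor \<open>exp (- q\<^sup>2 v / 2)\<close> in the exponent.
\<close>
lemma
  assumes md: "martingale_differences M F U"
    and bdd: "\<And>n. AE x in M. \<bar>U (n + 1) x\<bar> \<le> K"
    and var: "\<And>n. AE x in M. real_cond_exp M (F n) (\<lambda>y. (U (n + 1) y)\<^sup>2) x = v"
    and v: "0 \<le> v" and K: "0 \<le> K"
  shows integrable_exp_martingale_sum:
          "integrable M (\<lambda>x. exp (\<Sum>k<m. c k * U (k + 1) x))" (is ?int)
    and exp_martingale_sum_ge:
          "(\<And>k. k < m \<Longrightarrow> \<bar>c k\<bar> \<le> q) \<Longrightarrow>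
           exp (exp (- (q * K + q\<^sup>2 * v / 2)) * (v / 2) * (\<Sum>k<m. (c k)\<^sup>2))
             \<le> (\<integral>x. exp (\<Sum>k<m. c k * U (k + 1) x) \<partial>M)"
    and exp_martingale_sum_le:
          "(\<And>k. k < m \<Longrightarrow> \<bar>c k\<bar> \<le> q) \<Longrightarrow>
           (\<integral>x. exp (\<Sum>k<m. c k * U (k + 1) x) \<partial>M)
             \<le> exp (exp (q * K) * (v / 2) * (\<Sum>k<m. (c k)\<^sup>2))"
proof -
  define Z where "Z m x = exp (\<Sum>k<m. c k * U (k + 1) x)" for m x
  have sub: "subalgebra M (F n)" for n
    using md by (simp add: martingale_differences_def)
  have mono: "sets (F i) \<subseteq> sets (F j)" if "i \<le> j" for i j
    using md that by (auto simp: martingale_differences_def filtration_def)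
  have sp: "space (F i) = space M" for i
    using sub by (simp add: subalgebra_def)
  have Umeas: "U (i + 1) \<in> borel_measurable (F j)" if "i + 1 \<le> j" for i j
    using md mono[OF that] sp
    by (auto simp: martingale_differences_def intro: measurable_from_subalg[of "F j" "F (i+1)"] simp: subalgebra_def)
  have UM: "U (i + 1) \<in> borel_measurable M" for i
    using measurable_from_subalg[OF sub Umeas[OF order_refl]] by simp
  have Uint: "integrable M (U (i + 1))" for i
    using md by (simp add: martingale_differences_def)
  have U0: "AE x in M. real_cond_exp M (F i) (U (i + 1)) x = 0" for i
    using md by (simp add: martingale_differences_def)
  have ZF: "Z m \<in> borel_measurable (F m)" for m
    unfolding Z_def by (intro measurable_compose[OF _ borel_measurable_exp] borel_measurable_sum borel_measurable_times
        borel_measurable_const Umeas) auto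
  have ZM: "Z m \<in> borel_measurable M" for m
    by (rule measurable_from_subalg[OF sub ZF])
  have Zpos: "0 < Z m x" for m x by (simp add: Z_def)
  have allbdd: "AE x in M. \<forall>k. \<bar>U (k + 1) x\<bar> \<le> K"
    using bdd by (simp add: AE_all_countable)
  have Zbdd: "AE x in M. norm (Z m x) \<le> exp (\<Sum>k<m. \<bar>c k\<bar> * K)" for m
    using allbdd
  proof eventually_elim
    case (elim x)
    have "c k * U (k + 1) x \<le> \<bar>c k\<bar> * K" for k
      using elim abs_mult[of "c k" "U (k + 1) x"] mult_left_mono[of "\<bar>U (k + 1) x\<bar>" K "\<bar>c k\<bar>"]
      by (smt (verit) abs_ge_zero)
    then show ?case by (auto simp: Z_def intro: sum_mono)
  qed
  have Zint: "integrable M (Z m)" for m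
    by (rule integrable_const_bound[OF Zbdd ZM])
  then show ?int by (simp add: Z_def[abs_def])
  have ZUp: "integrable M (\<lambda>x. Z m x * (U (m + 1) x) ^ p)" for m p
  proof (rule integrable_const_bound)
    show "AE x in M. norm (Z m x * U (m + 1) x ^ p) \<le> exp (\<Sum>k<m. \<bar>c k\<bar> * K) * K ^ p"
      using Zbdd[of m] bdd[of m]
    proof eventually_elim
      case (elim x)
      then show ?case
        by (auto simp: abs_mult power_abs intro!: mult_mono power_mono)
    qed
  qed (use ZM UM in measurable)
  have U2int: "integrable M (\<lambda>x. (U (i + 1) x)\<^sup>2)" for i
  proof (rule integrable_const_bound)
    show "AE x in M. norm ((U (i + 1) x)\<^sup>2) \<le> K\<^sup>2"
      using bdd[of i]
      by eventually_elim (metis abs_ge_zero norm_power power_mono real_norm_def)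
  qed (use UM in measurable)
  have EZU: "(\<integral>x. Z m x * U (m + 1) x \<partial>M) = 0" for m
    using integral_mult_const_cond_exp[OF sub ZF Zint Uint _ U0] ZUp[of m 1] by simp
  have EZU2: "(\<integral>x. Z m x * (U (m + 1) x)\<^sup>2 \<partial>M) = v * (\<integral>x. Z m x \<partial>M)" for m
    using integral_mult_const_cond_exp[OF sub ZF Zint U2int ZUp var] .
  have quad_int: "integrable M (\<lambda>x. Z m x * (1 + c m * U (m + 1) x + e * (c m * U (m + 1) x)\<^sup>2 / 2))"
    and quad: "(\<integral>x. Z m x * (1 + c m * U (m + 1) x + e * (c m * U (m + 1) x)\<^sup>2 / 2) \<partial>M)
      = (1 + e * (v / 2 * (c m)\<^sup>2)) * (\<integral>x. Z m x \<partial>M)" for m e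
  proof -
    have eq: "Z m x * (1 + c m * U (m + 1) x + e * (c m * U (m + 1) x)\<^sup>2 / 2)
      = Z m x + c m * (Z m x * U (m + 1) x) + (e * (c m)\<^sup>2 / 2) * (Z m x * (U (m + 1) x)\<^sup>2)" for x
      by (simp add: algebra_simps power_mult_distrib)
    have i1: "integrable M (\<lambda>x. c m * (Z m x * U (m + 1) x))"
      using ZUp[of m 1] by simp
    have i2: "integrable M (\<lambda>x. (e * (c m)\<^sup>2 / 2) * (Z m x * (U (m + 1) x)\<^sup>2))"
      using ZUp[of m 2] by (rule integrable_mult_right)
    show "integrable M (\<lambda>x. Z m x * (1 + c m * U (m + 1) x + e * (c m * U (m + 1) x)\<^sup>2 / 2))"
      unfolding eq by (intro Bochner_Integration.integrable_add Zint i1 i2)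
    have "(\<integral>x. Z m x * (1 + c m * U (m + 1) x + e * (c m * U (m + 1) x)\<^sup>2 / 2) \<partial>M)
      = (\<integral>x. Z m x \<partial>M) + (\<integral>x. c m * (Z m x * U (m + 1) x) \<partial>M)
         + (\<integral>x. (e * (c m)\<^sup>2 / 2) * (Z m x * (U (m + 1) x)\<^sup>2) \<partial>M)"
      unfolding eq using Zint i1 i2
      by (simp only: Bochner_Integration.integral_add Bochner_Integration.integrable_add)
    also have "\<dots> = (1 + e * (v / 2 * (c m)\<^sup>2)) * (\<integral>x. Z m x \<partial>M)"
      by (simp only: integral_mult_right_zero EZU EZU2) (simp add: algebra_simps)
    finally show "(\<integral>x. Z m x * (1 + c m * U (m + 1) x + e * (c m * U (m + 1) x)\<^sup>2 / 2) \<partial>M)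
      = (1 + e * (v / 2 * (c m)\<^sup>2)) * (\<integral>x. Z m x \<partial>M)" .
  qed
  have Zsuc: "Z (Suc m) x = Z m x * exp (c m * U (m + 1) x)" for m x
    by (simp add: Z_def exp_add)
  have EZ0: "(\<integral>x. Z 0 x \<partial>M) = 1" by (simp add: Z_def prob_space)
  have EZnn: "0 \<le> (\<integral>x. Z m x \<partial>M)" for m
    by (intro integral_nonneg_AE) (simp add: Z_def)
  have small: "AE x in M. \<bar>c m * U (m + 1) x\<bar> \<le> q * K" if "\<bar>c m\<bar> \<le> q" for m
    using bdd[of m]
    by eventually_elim (use that in \<open>auto simp: abs_mult intro!: mult_mono\<close>)

  show "exp (exp (- (q * K + q\<^sup>2 * v / 2)) * (v / 2) * (\<Sum>k<m. (c k)\<^sup>2))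
      \<le> (\<integral>x. exp (\<Sum>k<m. c k * U (k + 1) x) \<partial>M)" if "\<And>k. k < m \<Longrightarrow> \<bar>c k\<bar> \<le> q"
  proof -
    define e where "e = exp (- (q * K + q\<^sup>2 * v / 2))"
    have "exp (e * (v / 2) * (\<Sum>k<m. (c k)\<^sup>2)) \<le> (\<integral>x. Z m x \<partial>M)"
      using that
    proof (induction m)
      case 0
      then show ?case by (simp add: EZ0)
    next
      case (Suc m)
      define y where "y = exp (- (q * K)) * (v / 2 * (c m)\<^sup>2)"
      have cm: "\<bar>c m\<bar> \<le> q" using Suc.prems by simp
      have y0: "0 \<le> y" using v by (simp add: y_def)
      have "(c m)\<^sup>2 \<le> q\<^sup>2" using cm by (metis abs_ge_zero power2_abs power_mono)
      then have "v / 2 * (c m)\<^sup>2 \<le> q\<^sup>2 * v / 2" using v mult_left_mono[of "(c m)\<^sup>2" "q\<^sup>2" "v/2"]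
        by (simp add: mult.commute)
      moreover have "y \<le> v / 2 * (c m)\<^sup>2"
        using v K cm by (auto simp: y_def intro!: mult_left_le_one_le)
      ultimately have y1: "y \<le> q\<^sup>2 * v / 2" by linarith
      have ey: "e * (v / 2) * (c m)\<^sup>2 = exp (- (q\<^sup>2 * v / 2)) * y"
      proof -
        have "e = exp (- (q\<^sup>2 * v / 2)) * exp (- (q * K))"
          by (simp add: e_def add_ac flip: exp_add)
        then show ?thesis by (simp add: y_def mult_ac)
      qed
      have "exp (e * (v / 2) * (\<Sum>k<Suc m. (c k)\<^sup>2))
          = exp (exp (- (q\<^sup>2 * v / 2)) * y) * exp (e * (v / 2) * (\<Sum>k<m. (c k)\<^sup>2))"
        using ey by (simp add: distrib_left exp_add)
      also have "\<dots> \<le> (1 + y) * (\<integral>x. Z m x \<partial>M)"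
        using exp_le_one_plus[OF y0 y1] Suc y0 by (intro mult_mono) auto
      also have "\<dots> = (\<integral>x. Z m x * (1 + c m * U (m + 1) x + exp (- (q * K)) * (c m * U (m + 1) x)\<^sup>2 / 2) \<partial>M)"
        by (simp only: quad y_def)
      also have "\<dots> \<le> (\<integral>x. Z (Suc m) x \<partial>M)"
      proof (rule integral_mono_AE[OF quad_int Zint])
        show "AE x in M. Z m x * (1 + c m * U (m + 1) x + exp (- (q * K)) * (c m * U (m + 1) x)\<^sup>2 / 2)
            \<le> Z (Suc m) x"
          using small[OF cm]
          by eventually_elim
            (use Zpos exp_quadratic_bounds(1) in \<open>simp only: Zsuc mult_le_cancel_left_pos\<close>)
      qed
      finally show ?case .
    qed
    then show ?thesis by (simp add: e_def Z_def)
  qed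

  show "(\<integral>x. exp (\<Sum>k<m. c k * U (k + 1) x) \<partial>M)
      \<le> exp (exp (q * K) * (v / 2) * (\<Sum>k<m. (c k)\<^sup>2))" if "\<And>k. k < m \<Longrightarrow> \<bar>c k\<bar> \<le> q"
  proof -
    have "(\<integral>x. Z m x \<partial>M) \<le> exp (exp (q * K) * (v / 2) * (\<Sum>k<m. (c k)\<^sup>2))"
      using that
    proof (induction m)
      case 0
      then show ?case by (simp add: EZ0)
    next
      case (Suc m)
      define y where "y = exp (q * K) * (v / 2 * (c m)\<^sup>2)"
      have cm: "\<bar>c m\<bar> \<le> q" using Suc.prems by simp
      have "(\<integral>x. Z (Suc m) x \<partial>M)
          \<le> (\<integral>x. Z m x * (1 + c m * U (m + 1) x + exp (q * K) * (c m * U (m + 1) x)\<^sup>2 / 2) \<partial>M)"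
      proof (rule integral_mono_AE[OF Zint quad_int])
        show "AE x in M. Z (Suc m) x
            \<le> Z m x * (1 + c m * U (m + 1) x + exp (q * K) * (c m * U (m + 1) x)\<^sup>2 / 2)"
          using small[OF cm]
          by eventually_elim
            (use Zpos exp_quadratic_bounds(2) in \<open>simp only: Zsuc mult_le_cancel_left_pos\<close>)
      qed
      also have "\<dots> = (1 + y) * (\<integral>x. Z m x \<partial>M)"
        by (simp only: quad y_def)
      also have "\<dots> \<le> exp y * exp (exp (q * K) * (v / 2) * (\<Sum>k<m. (c k)\<^sup>2))"
        using exp_ge_add_one_self[of y] Suc EZnn by (intro mult_mono) auto
      also have "\<dots> = exp (exp (q * K) * (v / 2) * (\<Sum>k<Suc m. (c k)\<^sup>2))"
        by (simp add: y_def algebra_simps flip: exp_add)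
      finally show ?case .
    qed
    then show ?thesis by (simp add: Z_def)
  qed
qed

section \<open>Gaussian tails from moment generating functions\<close>

text \<open>
  The upper bound is Chernoff's inequality at \<^term>\<open>t = r / v\<close>, on both sides. For the lower bound
  let \<^term>\<open>t = (r + \<delta>) / v\<close>: the measure with density proportional to \<open>exp (t a Y)\<close> concentrates
  near \<^term>\<open>r + \<delta>\<close>, hence in the window between \<^term>\<open>r\<close> and \<^term>\<open>r + 2 * \<delta>\<close>. On this window
  the density factor is at most \<open>exp (t a (r + 2 \<delta>))\<close>, which bounds the original probability below.
  Letting \<^term>\<open>\<delta>\<close> tend to 0 gives the exponent \<open>- r\<^sup>2 / (2 v)\<close>. The tilted measure is never
  constructed: a pointwise inequality between exponentials expresses that the mass outside the window
  is controlled by the moment generating function at \<open>t - s\<close> and \<open>t + s\<close>.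
\<close>
lemma gaussian_gaertner_ellis:
  fixes Y :: "nat \<Rightarrow> 'a \<Rightarrow> real" and a :: "nat \<Rightarrow> real"
  assumes a: "filterlim a at_top sequentially"
    and Y[measurable]: "\<And>n. Y n \<in> borel_measurable M"
    and int: "\<And>n t. integrable M (\<lambda>x. exp (t * a n * Y n x))"
    and lim: "\<And>t. (\<lambda>n. ln (\<integral>x. exp (t * a n * Y n x) \<partial>M) / a n) \<longlonglongrightarrow> t\<^sup>2 * v / 2"
    and v: "0 < v" and r: "0 < r"
  shows "(\<lambda>n. ln (prob {x \<in> space M. r < \<bar>Y n x\<bar>}) / a n) \<longlonglongrightarrow> - (r\<^sup>2 / (2 * v))"
proof -
  define E where "E t n = (\<integral>x. exp (t * a n * Y n x) \<partial>M)" for t n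
  define P where "P n = prob {x \<in> space M. r < \<bar>Y n x\<bar>}" for n
  have apos: "\<forall>\<^sub>F n in sequentially. 0 < a n"
    using a by (simp add: filterlim_at_top_dense)
  have Epos: "0 < E t n" for t n
    unfolding E_def by (rule expectation_greater[OF int]) simp
  have E_upper: "\<forall>\<^sub>F n in sequentially. E t n \<le> exp (a n * (t\<^sup>2 * v / 2 + \<eta>))" if "0 < \<eta>" for t \<eta>
  proof -
    have "\<forall>\<^sub>F n in sequentially. ln (E t n) / a n < t\<^sup>2 * v / 2 + \<eta>"
      using order_tendstoD(2)[OF lim[of t], of "t\<^sup>2 * v / 2 + \<eta>"] that by (simp add: E_def)
    with apos show ?thesis
    proof eventually_elim
      case (elim n)
      then have "ln (E t n) \<le> a n * (t\<^sup>2 * v / 2 + \<eta>)" by (simp add: pos_divide_less_eq mult.commute less_imp_le)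
      then show ?case using Epos[of t n] by (metis exp_le_cancel_iff exp_ln)
    qed
  qed
  have E_lower: "\<forall>\<^sub>F n in sequentially. exp (a n * (t\<^sup>2 * v / 2 - \<eta>)) \<le> E t n" if "0 < \<eta>" for t \<eta>
  proof -
    have "\<forall>\<^sub>F n in sequentially. t\<^sup>2 * v / 2 - \<eta> < ln (E t n) / a n"
      using order_tendstoD(1)[OF lim[of t], of "t\<^sup>2 * v / 2 - \<eta>"] that by (simp add: E_def)
    with apos show ?thesis
    proof eventually_elim
      case (elim n)
      then have "a n * (t\<^sup>2 * v / 2 - \<eta>) \<le> ln (E t n)" by (simp add: pos_less_divide_eq mult.commute less_imp_le)
      then show ?case using Epos[of t n] by (metis exp_le_cancel_iff exp_ln)
    qed
  qed
  have large: "\<forall>\<^sub>F n in sequentially. B < a n * d" if "0 < d" for B d :: real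
  proof -
    have "\<forall>\<^sub>F n in sequentially. B / d < a n" using a by (simp add: filterlim_at_top_dense)
    then show ?thesis by eventually_elim (use that in \<open>simp add: field_simps\<close>)
  qed
  have P_set: "{x \<in> space M. r < \<bar>Y n x\<bar>} \<inter> space M = {x \<in> space M. r < \<bar>Y n x\<bar>}" for n
    by auto
  have chernoff: "P n \<le> exp (- (t * r * a n)) * (E t n + E (- t) n)" if "0 \<le> t" "0 < a n" for t n
  proof -
    have "P n = (\<integral>x. indicator {x \<in> space M. r < \<bar>Y n x\<bar>} x \<partial>M)"
      unfolding P_def by (simp add: P_set)
    also have "\<dots> \<le> (\<integral>x. exp (- (t * r * a n)) * (exp (t * a n * Y n x) + exp (- t * a n * Y n x)) \<partial>M)"
    proof (rule integral_mono)
      fix x assume "x \<in> space M"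
      have *: "1 \<le> exp (- (t * r * a n)) * exp (t * a n * y)" if "r < y" for y
      proof -
        have "t * a n * r \<le> t * a n * y" using that \<open>0 \<le> t\<close> \<open>0 < a n\<close> by (intro mult_left_mono) auto
        then show ?thesis by (simp add: algebra_simps flip: exp_add)
      qed
      show "indicator {x \<in> space M. r < \<bar>Y n x\<bar>} x \<le>
          exp (- (t * r * a n)) * (exp (t * a n * Y n x) + exp (- t * a n * Y n x))"
        using *[of "Y n x"] *[of "- Y n x"] \<open>x \<in> space M\<close>
        by (auto simp: indicator_def distrib_left abs_if add_nonneg_nonneg add_increasing add_increasing2 split: if_splits)
    qed (use int[of t n] int[of "- t" n] in \<open>auto simp: less_top[symmetric]\<close>)
    also have "\<dots> = exp (- (t * r * a n)) * (E t n + E (- t) n)"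
      using int[of t n] int[of "- t" n] by (simp add: E_def)
    finally show ?thesis .
  qed
  \<comment> \<open>After division by \<open>exp (t a Y)\<close>, the two subtracted terms are \<open>exp (s a (r - Y))\<close> and
    \<open>exp (s a (Y - R))\<close>. One of them is at least 1 as soon as \<open>Y\<close> leaves the window, and then the
    integrand is not positive.\<close>
  have tilt: "exp (- (t * R * a n)) * (E t n - exp (s * r * a n) * E (t - s) n - exp (- (s * R * a n)) * E (t + s) n) \<le> P n"
    if "0 \<le> t" "0 \<le> s" "0 < a n" for t s R n
  proof -
    have "exp (- (t * R * a n)) * (E t n - exp (s * r * a n) * E (t - s) n - exp (- (s * R * a n)) * E (t + s) n)
      = (\<integral>x. exp (- (t * R * a n)) * (exp (t * a n * Y n x) - exp (s * r * a n) * exp ((t - s) * a n * Y n x)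
           - exp (- (s * R * a n)) * exp ((t + s) * a n * Y n x)) \<partial>M)"
      using int[of t n] int[of "t - s" n] int[of "t + s" n] by (simp add: E_def)
    also have "\<dots> \<le> (\<integral>x. indicator {x \<in> space M. r < \<bar>Y n x\<bar>} x \<partial>M)"
    proof (rule integral_mono)
      fix x assume x: "x \<in> space M"
      define y where "y = Y n x"
      have e1: "exp (s * r * a n) * exp ((t - s) * a n * y) = exp (t * a n * y) * exp (s * a n * (r - y))"
        and e2: "exp (- (s * R * a n)) * exp ((t + s) * a n * y) = exp (t * a n * y) * exp (s * a n * (y - R))"
        by (simp_all add: algebra_simps flip: exp_add)
      let ?D = "exp (t * a n * y) - exp (t * a n * y) * exp (s * a n * (r - y)) - exp (t * a n * y) * exp (s * a n * (y - R))"
      consider "y \<le> r" | "R \<le> y" | "r < y" "y < R" by linarith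
      then have "exp (- (t * R * a n)) * ?D \<le> (if r < y then 1 else 0)"
      proof cases
        case 1
        then have "1 \<le> exp (s * a n * (r - y))" using that by simp
        then have "?D \<le> 0" using mult_left_mono[of 1 "exp (s * a n * (r - y))" "exp (t * a n * y)"]
          by (smt (verit) exp_gt_zero mult_pos_pos)
        then have "exp (- (t * R * a n)) * ?D \<le> 0" by (simp add: mult_nonneg_nonpos)
        then show ?thesis by simp
      next
        case 2
        then have "1 \<le> exp (s * a n * (y - R))" using that by simp
        then have "?D \<le> 0" using mult_left_mono[of 1 "exp (s * a n * (y - R))" "exp (t * a n * y)"]
          by (smt (verit) exp_gt_zero mult_pos_pos)
        then have "exp (- (t * R * a n)) * ?D \<le> 0" by (simp add: mult_nonneg_nonpos)
        then show ?thesis by simp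
      next
        case 3
        have "?D \<le> exp (t * a n * y)"
          by (smt (verit) exp_gt_zero mult_pos_pos)
        then have "exp (- (t * R * a n)) * ?D \<le> exp (- (t * R * a n)) * exp (t * a n * y)"
          by (intro mult_left_mono) auto
        also have "\<dots> = exp (- (t * a n * (R - y)))" by (simp add: algebra_simps flip: exp_add)
        also have "\<dots> \<le> 1" using that 3 by simp
        finally show ?thesis using 3 by simp
      qed
      also have "\<dots> \<le> (indicator {x \<in> space M. r < \<bar>Y n x\<bar>} x :: real)"
        using x by (auto simp: y_def indicator_def)
      finally show "exp (- (t * R * a n)) * (exp (t * a n * Y n x) - exp (s * r * a n) * exp ((t - s) * a n * Y n x)
           - exp (- (s * R * a n)) * exp ((t + s) * a n * Y n x)) \<le> indicator {x \<in> space M. r < \<bar>Y n x\<bar>} x"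
        by (simp only: e1[unfolded y_def] e2[unfolded y_def] y_def)
    qed (use int[of t n] int[of "t - s" n] int[of "t + s" n] in \<open>auto simp: less_top[symmetric]\<close>)
    also have "\<dots> = P n"
      unfolding P_def by (simp add: P_set)
    finally show ?thesis .
  qed
  have lower: "\<forall>\<^sub>F n in sequentially.
      exp (a n * (- (r\<^sup>2 / (2 * v)) - 2 * r * \<delta> / v - 2 * \<delta>\<^sup>2 / v)) \<le> P n" if \<delta>: "0 < \<delta>" for \<delta>
  proof -
    \<comment> \<open>This \<open>s\<close> minimises \<open>- s \<delta> + s\<^sup>2 v / 2\<close>, the exponent (beyond that of \<open>E t\<close>) of the mass on
      either side of the window. The minimum is \<open>- \<delta>\<^sup>2 / (2 v) = - 4 \<eta>\<close>, of which the approximation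
      errors of the three moment generating functions use \<open>2 \<eta>\<close>, one for \<open>E t\<close> and one for the others.\<close>
    define s where "s = \<delta> / v"
    define t where "t = (r + \<delta>) / v"
    define R where "R = r + 2 * \<delta>"
    define \<eta> where "\<eta> = \<delta>\<^sup>2 / (8 * v)"
    define L where "L = t\<^sup>2 * v / 2 - \<eta>"
    have pos: "0 < s" "0 < t" "0 < \<eta>" using \<delta> v r by (auto simp: s_def t_def \<eta>_def)
    have e1: "s * r + ((t - s)\<^sup>2 * v / 2 + \<eta>) = L - 2 * \<eta>"
      and e2: "- (s * R) + ((t + s)\<^sup>2 * v / 2 + \<eta>) = L - 2 * \<eta>"
      and e3: "- (r\<^sup>2 / (2 * v)) - 2 * r * \<delta> / v - 2 * \<delta>\<^sup>2 / v \<le> - (t * R) + L - \<eta>"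
      using v \<delta> by (simp_all add: s_def t_def R_def \<eta>_def L_def field_simps power2_eq_square)
    show ?thesis
      using apos E_lower[OF pos(3), of t] E_upper[OF pos(3), of "t - s"] E_upper[OF pos(3), of "t + s"]
        large[OF pos(3), of "ln 4"]
    proof eventually_elim
      case (elim n)
      have b1: "exp (s * r * a n) * E (t - s) n \<le> exp (a n * (L - 2 * \<eta>))"
      proof -
        have "exp (s * r * a n) * E (t - s) n \<le> exp (s * r * a n) * exp (a n * ((t - s)\<^sup>2 * v / 2 + \<eta>))"
          using elim by (intro mult_left_mono) auto
        also have "\<dots> = exp (a n * (s * r + ((t - s)\<^sup>2 * v / 2 + \<eta>)))"
          by (simp add: algebra_simps flip: exp_add)
        finally show ?thesis by (simp only: e1)
      qed
      have b2: "exp (- (s * R * a n)) * E (t + s) n \<le> exp (a n * (L - 2 * \<eta>))"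
      proof -
        have "exp (- (s * R * a n)) * E (t + s) n \<le> exp (- (s * R * a n)) * exp (a n * ((t + s)\<^sup>2 * v / 2 + \<eta>))"
          using elim by (intro mult_left_mono) auto
        also have "\<dots> = exp (a n * (- (s * R) + ((t + s)\<^sup>2 * v / 2 + \<eta>)))"
          by (simp add: algebra_simps flip: exp_add)
        finally show ?thesis by (simp only: e2)
      qed
      have "4 \<le> exp (a n * \<eta>)"
        using elim(5) by (metis exp_le_cancel_iff exp_ln less_imp_le zero_less_numeral)
      then have "exp w * 4 \<le> exp w * exp (a n * \<eta>)" for w :: real
        by (intro mult_left_mono) auto
      from this[of "a n * (L - 2 * \<eta>)"] this[of "a n * (L - \<eta>)"]
      have b3: "exp (a n * (L - 2 * \<eta>)) * 4 \<le> exp (a n * (L - \<eta>))"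
          "exp (a n * (L - \<eta>)) * 4 \<le> exp (a n * L)"
        by (simp_all add: algebra_simps flip: exp_add)
      have "exp (a n * (L - \<eta>)) \<le> E t n - exp (s * r * a n) * E (t - s) n - exp (- (s * R * a n)) * E (t + s) n"
        using b1 b2 b3 elim(2) exp_gt_zero[of "a n * (L - \<eta>)"] unfolding L_def[symmetric] by linarith
      then have "exp (- (t * R * a n)) * exp (a n * (L - \<eta>)) \<le> P n"
        by (intro order_trans[OF _ tilt[of t s n R]] mult_left_mono) (use pos elim(1) in auto)
      moreover have "exp (a n * (- (r\<^sup>2 / (2 * v)) - 2 * r * \<delta> / v - 2 * \<delta>\<^sup>2 / v))
          \<le> exp (- (t * R * a n)) * exp (a n * (L - \<eta>))"
        using mult_left_mono[OF e3, of "a n"] elim(1) by (simp add: algebra_simps flip: exp_add)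
      ultimately show ?case by linarith
    qed
  qed
  show ?thesis
    unfolding P_def[symmetric]
  proof (rule order_tendstoI)
    fix l assume l: "l < - (r\<^sup>2 / (2 * v))"
    have "((\<lambda>\<delta>. - (r\<^sup>2 / (2 * v)) - 2 * r * \<delta> / v - 2 * \<delta>\<^sup>2 / v) \<longlongrightarrow> - (r\<^sup>2 / (2 * v)) - 2 * r * 0 / v - 2 * 0\<^sup>2 / v) (at_right 0)"
      by (intro tendsto_intros) (use v in auto)
    then have "\<forall>\<^sub>F \<delta> in at_right 0. l < - (r\<^sup>2 / (2 * v)) - 2 * r * \<delta> / v - 2 * \<delta>\<^sup>2 / v"
      using l by (intro order_tendstoD(1)) auto
    moreover have "\<forall>\<^sub>F \<delta> in at_right (0::real). 0 < \<delta>" by (simp add: eventually_at_right_less)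
    ultimately obtain \<delta> where \<delta>: "0 < \<delta>" "l < - (r\<^sup>2 / (2 * v)) - 2 * r * \<delta> / v - 2 * \<delta>\<^sup>2 / v"
      by (metis (mono_tags, lifting) eventually_conj eventually_happens trivial_limit_at_right_real)
    show "\<forall>\<^sub>F n in sequentially. l < ln (P n) / a n"
      using apos lower[OF \<delta>(1)]
    proof eventually_elim
      case (elim n)
      have "0 < P n" using elim(2) exp_gt_zero less_le_trans by blast
      then have "a n * (- (r\<^sup>2 / (2 * v)) - 2 * r * \<delta> / v - 2 * \<delta>\<^sup>2 / v) \<le> ln (P n)"
        using elim(2) by (simp add: ln_ge_iff)
      moreover have "a n * l < a n * (- (r\<^sup>2 / (2 * v)) - 2 * r * \<delta> / v - 2 * \<delta>\<^sup>2 / v)"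
        using \<delta>(2) elim(1) by (rule mult_strict_left_mono)
      ultimately have "a n * l < ln (P n)" by (rule less_le_trans[rotated])
      then show ?case using elim(1) by (simp add: pos_less_divide_eq mult.commute)
    qed
  next
    fix u assume u: "- (r\<^sup>2 / (2 * v)) < u"
    define \<eta> where "\<eta> = (u + r\<^sup>2 / (2 * v)) / 2"
    have \<eta>: "0 < \<eta>" using u by (simp add: \<eta>_def)
    define t where "t = r / v"
    have t: "0 \<le> t" using r v by (simp add: t_def)
    have e: "- (t * r) + (t\<^sup>2 * v / 2 + \<eta>) = u - \<eta>"
      using v by (simp add: t_def \<eta>_def field_simps power2_eq_square)
    show "\<forall>\<^sub>F n in sequentially. ln (P n) / a n < u"
      using apos lower[OF zero_less_one] E_upper[OF \<eta>, of t] E_upper[OF \<eta>, of "- t"] large[OF \<eta>, of "ln 2"]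
    proof eventually_elim
      case (elim n)
      have Pp: "0 < P n" using elim(2) exp_gt_zero less_le_trans by blast
      have "P n \<le> exp (- (t * r * a n)) * (E t n + E (- t) n)" using chernoff t elim(1) by blast
      also have "\<dots> \<le> exp (- (t * r * a n)) * (2 * exp (a n * (t\<^sup>2 * v / 2 + \<eta>)))"
        using elim(3,4) by (intro mult_left_mono) auto
      also have "\<dots> = 2 * exp (a n * (- (t * r) + (t\<^sup>2 * v / 2 + \<eta>)))"
        by (simp add: algebra_simps flip: exp_add)
      finally have "P n \<le> 2 * exp (a n * (u - \<eta>))" by (simp only: e)
      then have "ln (P n) \<le> ln (2 * exp (a n * (u - \<eta>)))" using Pp by simp
      also have "\<dots> = ln 2 + a n * (u - \<eta>)" by (simp add: ln_mult)
      also have "\<dots> < a n * u" using elim(5) by (simp add: algebra_simps)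
      finally show ?case using elim(1) by (simp add: pos_divide_less_eq mult.commute)
    qed
  qed
qed

end

section \<open>Size of the weights\<close>

lemma beta_prod_diag [simp]: "beta_prod c (Suc n) n = 1"
  by (simp add: beta_prod_def)

lemma beta_prod_Suc:
  assumes "k \<le> n"
  shows "beta_prod c (Suc k) (Suc n) = beta_prod c (Suc k) n * (1 + c / (real n + 2))"
  using assms by (simp add: beta_prod_def prod.nat_ivl_Suc' mult.commute add.commute)

definition weight :: "real \<Rightarrow> nat \<Rightarrow> nat \<Rightarrow> real" where
  "weight c n k = 1 / (real k + 1) * beta_prod c (k + 1) n"

lemma weight_diag: "weight c n n = 1 / (real n + 1)"
  by (simp add: weight_def)

lemma weight_Suc: "k \<le> n \<Longrightarrow> weight c (Suc n) k = (1 + c / (real n + 2)) * weight c n k"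
  by (simp add: weight_def beta_prod_Suc)

text \<open>
  Once \<^prop>\<open>\<bar>c\<bar> \<le> real n\<close>, passing from \<^term>\<open>n\<close> to \<^term>\<open>Suc n\<close> multiplies a weight by
  \<open>1 + c / (n + 2)\<close>, which is nonnegative and at most \<open>(n + 1) / (n + 2)\<close> because \<^prop>\<open>c \<le> - 1\<close>;
  this telescopes to \<open>1 / (n + 1)\<close>. Each of the finitely many earlier steps, where the factor may
  be negative and large, is at most \<^term>\<open>D\<close> times worse.
\<close>
lemma weight_upper_bound:
  assumes "c \<le> - 1"
  obtains C where "0 < C" "\<And>n k. k \<le> n \<Longrightarrow> \<bar>weight c n k\<bar> \<le> C / (real n + 1)"
proof -
  define D where "D = 2 * (1 + \<bar>c\<bar>)"
  define J where "J = nat \<lceil>\<bar>c\<bar>\<rceil>"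
  have D: "1 \<le> D" by (simp add: D_def)
  have J: "\<bar>c\<bar> \<le> real J" by (simp add: J_def)
  have abs_factor: "\<bar>1 + c / (real n + 2)\<bar> = \<bar>real n + 2 + c\<bar> / (real n + 2)" for n
  proof -
    have "1 + c / (real n + 2) = (real n + 2 + c) / (real n + 2)" by (simp add: field_simps)
    then show ?thesis by (simp add: abs_divide)
  qed
  have factor: "\<bar>1 + c / (real n + 2)\<bar> * D ^ min n J \<le> D ^ min (Suc n) J * ((real n + 1) / (real n + 2))" for n
  proof (cases "n < J")
    case True
    have "\<bar>1 + c / (real n + 2)\<bar> \<le> D * (real n + 1) / (real n + 2)"
      unfolding abs_factor
    proof (intro divide_right_mono)
      have "\<bar>real n + 2 + c\<bar> \<le> real n + 2 + \<bar>c\<bar>" by simp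
      also have "\<dots> \<le> D * (real n + 1)" by (simp add: D_def algebra_simps)
      finally show "\<bar>real n + 2 + c\<bar> \<le> D * (real n + 1)" .
    qed simp
    then have "\<bar>1 + c / (real n + 2)\<bar> * D ^ n \<le> D * (real n + 1) / (real n + 2) * D ^ n"
      using D by (intro mult_right_mono) auto
    then show ?thesis using True by (simp add: mult_ac)
  next
    case False
    then have "\<bar>c\<bar> \<le> real n" using J by linarith
    then have "\<bar>1 + c / (real n + 2)\<bar> \<le> (real n + 1) / (real n + 2)"
      unfolding abs_factor using assms by (intro divide_right_mono) auto
    then have "\<bar>1 + c / (real n + 2)\<bar> * D ^ J \<le> (real n + 1) / (real n + 2) * D ^ J"
      using D by (intro mult_right_mono) auto
    moreover have "min n J = J" "min (Suc n) J = J" using False by auto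
    ultimately show ?thesis by (simp only: mult.commute)
  qed
  have "\<bar>weight c n k\<bar> \<le> D ^ min n J / (real n + 1)" if "k \<le> n" for n k
    using that
  proof (induction n rule: dec_induct)
    case base
    then show ?case using D by (simp add: weight_diag divide_right_mono)
  next
    case (step n)
    have "\<bar>weight c (Suc n) k\<bar> = \<bar>1 + c / (real n + 2)\<bar> * \<bar>weight c n k\<bar>"
      using step by (simp add: weight_Suc abs_mult)
    also have "\<dots> \<le> \<bar>1 + c / (real n + 2)\<bar> * (D ^ min n J / (real n + 1))"
      using step by (intro mult_left_mono) auto
    also have "\<dots> \<le> D ^ min (Suc n) J * ((real n + 1) / (real n + 2)) / (real n + 1)"
      unfolding times_divide_eq_right[of _ _ "real n + 1"] by (intro divide_right_mono factor) simp
    also have "\<dots> = D ^ min (Suc n) J / (real (Suc n) + 1)"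
      by (simp add: add.commute)
    finally show ?case .
  qed
  moreover have "D ^ min n J / (real n + 1) \<le> D ^ J / (real n + 1)" for n
    using D by (intro divide_right_mono power_increasing) auto
  ultimately have "\<bar>weight c n k\<bar> \<le> D ^ J / (real n + 1)" if "k \<le> n" for n k
    using that order_trans by blast
  then show ?thesis using that[of "D ^ J"] D by simp
qed

text \<open>
  The sum satisfies the recursion \<open>S (n + 1) = (1 + c / (n + 2))\<^sup>2 S n + 1 / (n + 2)\<^sup>2\<close>. By
  \<open>(1 + x)\<^sup>2 \<ge> 1 + 2 x\<close> its first term costs a lower bound \<open>d / (n + 1)\<close> at most
  \<open>2 \<bar>c\<bar> d / ((n + 1) (n + 2))\<close>. For \<open>d = 1 / (4 \<bar>c\<bar>)\<close> this is \<open>1 / (2 (n + 1) (n + 2))\<close>, which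
  the new term \<open>1 / (n + 2)\<^sup>2\<close> makes up for.
\<close>
lemma sum_weight_squares_lower_bound:
  assumes "c \<le> - 1"
  shows "1 / (4 * \<bar>c\<bar>) / (real n + 1) \<le> (\<Sum>k\<le>n. (weight c n k)\<^sup>2)"
proof (induction n)
  case 0
  then show ?case using assms by (simp add: weight_diag[of c 0, simplified] field_simps)
next
  case (Suc n)
  define d where "d = 1 / (4 * \<bar>c\<bar>)"
  define x where "x = real n + 2"
  have x: "2 \<le> x" by (simp add: x_def)
  have d: "0 < d" "c * d = - 1 / 4" using assms by (auto simp: d_def field_simps)
  have "d / x \<le> (1 + 2 * (c / x)) * (d / (x - 1)) + (1 / x)\<^sup>2"
  proof -
    have "(1 + 2 * (c / x)) * (d / (x - 1)) + (1 / x)\<^sup>2 - d / x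
        = (d * x + 2 * (c * d) * x + (x - 1)) / (x\<^sup>2 * (x - 1))"
      using x by (simp add: divide_simps power2_eq_square) (simp add: algebra_simps power2_eq_square)
    also have "\<dots> \<ge> 0"
    proof (intro divide_nonneg_nonneg)
      have "0 < d * x" using x d by simp
      then show "0 \<le> d * x + 2 * (c * d) * x + (x - 1)" unfolding d(2) using x by simp
    qed (use x in auto)
    finally show ?thesis by simp
  qed
  also have "\<dots> \<le> (1 + c / x)\<^sup>2 * (d / (x - 1)) + (1 / x)\<^sup>2"
  proof (intro add_right_mono mult_right_mono)
    show "1 + 2 * (c / x) \<le> (1 + c / x)\<^sup>2"
      unfolding power2_sum by simp
  qed (use d(1) x in auto)
  also have "\<dots> \<le> (1 + c / x)\<^sup>2 * (\<Sum>k\<le>n. (weight c n k)\<^sup>2) + (1 / x)\<^sup>2"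
    using Suc by (intro add_right_mono mult_left_mono) (auto simp: d_def x_def add.commute)
  also have "\<dots> = (\<Sum>k\<le>Suc n. (weight c (Suc n) k)\<^sup>2)"
    by (simp add: weight_Suc weight_diag power_mult_distrib sum_distrib_left x_def add.commute)
  finally show ?case by (simp add: d_def x_def add.commute)
qed

definition normed_weight :: "real \<Rightarrow> real \<Rightarrow> nat \<Rightarrow> nat \<Rightarrow> real" where
  "normed_weight b \<alpha> n k = h_norm b \<alpha> n * (b * weight (b * \<alpha>) n k)"

lemma h_norm_eq: "h_norm b \<alpha> n = 1 / sqrt (b\<^sup>2 * (\<Sum>k\<le>n. (weight (b * \<alpha>) n k)\<^sup>2))"
proof -
  have "(\<Sum>k=0..n. 1 / (real k + 1)\<^sup>2 * (beta_prod (b * \<alpha>) (k + 1) n)\<^sup>2) = (\<Sum>k\<le>n. (weight (b * \<alpha>) n k)\<^sup>2)"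
    by (simp add: weight_def power_divide atLeast0AtMost)
  moreover have "0 \<le> b\<^sup>2 * (\<Sum>k\<le>n. (weight (b * \<alpha>) n k)\<^sup>2)"
    by (intro mult_nonneg_nonneg sum_nonneg) auto
  ultimately show ?thesis
    unfolding h_norm_def by (simp add: powr_minus_divide powr_half_sqrt)
qed

lemma
  assumes "b * \<alpha> \<le> - 1"
  shows sum_normed_weight_squares: "(\<Sum>k\<le>n. (normed_weight b \<alpha> n k)\<^sup>2) = 1"
    and normed_weight_bound:
      "\<exists>D>0. \<forall>n k. k \<le> n \<longrightarrow> \<bar>normed_weight b \<alpha> n k\<bar> \<le> D / sqrt (real n + 1)"
proof -
  define c where "c = b * \<alpha>"
  define S where "S n = (\<Sum>k\<le>n. (weight c n k)\<^sup>2)" for n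
  define d where "d = 1 / (4 * \<bar>c\<bar>)"
  have b: "b \<noteq> 0" using assms by auto
  have "c < 0" using assms by (simp add: c_def)
  then have d: "0 < d" by (simp add: d_def)
  have S: "d / (real n + 1) \<le> S n" for n
    using sum_weight_squares_lower_bound[of c n] assms by (simp add: c_def d_def S_def)
  have Spos: "0 < S n" for n
    using d by (intro less_le_trans[OF _ S]) simp
  have h: "h_norm b \<alpha> n * \<bar>b\<bar> = 1 / sqrt (S n)" for n
    using b by (simp add: h_norm_eq S_def c_def real_sqrt_mult)
  have "(\<Sum>k\<le>n. (normed_weight b \<alpha> n k)\<^sup>2) = (h_norm b \<alpha> n * \<bar>b\<bar>)\<^sup>2 * S n"
    by (simp add: normed_weight_def S_def sum_distrib_left power_mult_distrib mult_ac c_def)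
  also have "\<dots> = 1" using Spos[of n] by (simp add: h power_divide)
  finally show "(\<Sum>k\<le>n. (normed_weight b \<alpha> n k)\<^sup>2) = 1" .
  obtain C where C: "0 < C" "\<And>n k. k \<le> n \<Longrightarrow> \<bar>weight c n k\<bar> \<le> C / (real n + 1)"
    using weight_upper_bound[of c] assms by (auto simp: c_def)
  have "\<bar>normed_weight b \<alpha> n k\<bar> \<le> C / sqrt d / sqrt (real n + 1)" if "k \<le> n" for n k
  proof -
    have "0 \<le> h_norm b \<alpha> n" by (simp add: h_norm_def)
    then have "\<bar>normed_weight b \<alpha> n k\<bar> = h_norm b \<alpha> n * \<bar>b\<bar> * \<bar>weight c n k\<bar>"
      by (simp add: normed_weight_def abs_mult c_def)
    also have "\<dots> \<le> 1 / sqrt (d / (real n + 1)) * (C / (real n + 1))"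
      unfolding h using S[of n] C that d by (intro mult_mono divide_left_mono) (auto simp: Spos)
    also have "\<dots> = C / sqrt d * (sqrt (real n + 1) / (real n + 1))"
      by (simp add: real_sqrt_divide)
    also have "\<dots> = C / sqrt d / sqrt (real n + 1)"
      using sqrt_divide_self_eq[of "real n + 1"] by (simp add: divide_inverse)
    finally show ?thesis .
  qed
  moreover have "0 < C / sqrt d" using C d by simp
  ultimately show "\<exists>D>0. \<forall>n k. k \<le> n \<longrightarrow> \<bar>normed_weight b \<alpha> n k\<bar> \<le> D / sqrt (real n + 1)"
    by blast
qed

section \<open>The moderate deviation principle\<close>

theorem theorem2p2:
  fixes M :: "'a measure"
    and F :: "nat \<Rightarrow> 'a measure"
    and U :: "nat \<Rightarrow> 'a \<Rightarrow> real"
    and K\<^sub>u \<sigma> b \<alpha>\<^sub>1 r :: real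
    and bs :: "nat \<Rightarrow> real"
  assumes "prob_space M"
    and "martingale_differences M F U"
    and "K\<^sub>u > 0"
    and "\<sigma> > 0"
    and "\<And>n. AE x in M. \<bar>U (n + 1) x\<bar> \<le> K\<^sub>u"
    and "\<And>n. AE x in M. real_cond_exp M (F n) (\<lambda>y. (U (n + 1) y)\<^sup>2) x = \<sigma>\<^sup>2"
    and "\<And>n. n \<ge> 1 \<Longrightarrow> bs n > 0"
    and "filterlim bs at_top sequentially"
    and "(\<lambda>n. bs n / sqrt (real n)) \<longlonglongrightarrow> 0"
    and "b * \<alpha>\<^sub>1 < -1"
    and "r > 0"
  shows "(\<lambda>n. 1 / (bs n)\<^sup>2 *
            ln (measure M {x \<in> space M.
              h_norm b \<alpha>\<^sub>1 n *
                \<bar>b * (\<Sum>k=0..n. 1 / (real k + 1) * beta_prod (b * \<alpha>\<^sub>1) (k + 1) n * U (k + 1) x)\<bar>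
              > r * bs n}))
         \<longlonglongrightarrow> - (r\<^sup>2 / (2 * \<sigma>\<^sup>2))"
proof -
  interpret prob_space M by fact
  note md = assms(2) and bdd = assms(5) and var = assms(6)
  define w where "w = normed_weight b \<alpha>\<^sub>1"
  define Y where "Y n x = (\<Sum>k<Suc n. w n k * U (k + 1) x) / bs n" for n x
  \<comment> \<open>The speed of the large deviations. With it, \<open>t * a n * Y n\<close> is \<open>t * bs n\<close> times the normalised
    sum, and the event is \<open>r < \<bar>Y n\<bar>\<close>.\<close>
  define a where "a n = (bs n)\<^sup>2" for n
  define G where "G t n = (\<integral>x. exp (t * a n * Y n x) \<partial>M)" for t n
  have c: "b * \<alpha>\<^sub>1 \<le> - 1" using assms(10) by simp
  have w_sq: "(\<Sum>k<Suc n. (w n k)\<^sup>2) = 1" for n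
    using sum_normed_weight_squares[OF c, of n] by (simp only: w_def lessThan_Suc_atMost)
  obtain D where D: "0 < D" "\<And>n k. k \<le> n \<Longrightarrow> \<bar>w n k\<bar> \<le> D / sqrt (real n + 1)"
    using normed_weight_bound[OF c] unfolding w_def by blast
  have UM: "U (k + 1) \<in> borel_measurable M" for k
    using md by (auto simp: martingale_differences_def)
  have YM: "Y n \<in> borel_measurable M" for n
    unfolding Y_def using UM by measurable
  have exp_Y: "exp (t * a n * Y n x) = exp (\<Sum>k<Suc n. (t * a n / bs n * w n k) * U (k + 1) x)" for t n x
    unfolding Y_def sum_divide_distrib sum_distrib_left by (intro arg_cong[where f = exp] sum.cong) auto
  have K: "0 \<le> K\<^sub>u" using assms(3) by simp
  have s2: "0 \<le> \<sigma>\<^sup>2" by simp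
  have int: "integrable M (\<lambda>x. exp (t * a n * Y n x))" for t n
    unfolding exp_Y by (rule integrable_exp_martingale_sum[OF md bdd var s2 K])
  have a_lim: "filterlim a at_top sequentially"
    unfolding a_def by (rule filterlim_pow_at_top[OF _ assms(8)]) simp
  have mgf: "(\<lambda>n. ln (G t n) / a n) \<longlonglongrightarrow> t\<^sup>2 * \<sigma>\<^sup>2 / 2" for t
  proof -
    \<comment> \<open>A common bound for the coefficients \<open>t * bs n * w n k\<close>, using \<open>1 / sqrt (n + 1) \<le> 1 / sqrt n\<close>.\<close>
    define q where "q n = \<bar>t\<bar> * D * (bs n / sqrt (real n))" for n
    have q_lim: "q \<longlonglongrightarrow> 0"
      unfolding q_def using tendsto_mult_right_zero[OF assms(9)] by simp
    have bounds: "exp (- (q n * K\<^sub>u + (q n)\<^sup>2 * \<sigma>\<^sup>2 / 2)) * (t\<^sup>2 * \<sigma>\<^sup>2 / 2) \<le> ln (G t n) / a n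
        \<and> ln (G t n) / a n \<le> exp (q n * K\<^sub>u) * (t\<^sup>2 * \<sigma>\<^sup>2 / 2)" if n: "1 \<le> n" for n
    proof -
      have bpos: "0 < bs n" using assms(7) n by simp
      then have apos: "0 < a n" by (simp add: a_def)
      have small: "\<bar>t * a n / bs n * w n k\<bar> \<le> q n" if "k < Suc n" for k
      proof -
        have "\<bar>t * a n / bs n * w n k\<bar> = \<bar>t\<bar> * bs n * \<bar>w n k\<bar>"
          using bpos by (simp add: a_def abs_mult power2_eq_square)
        also have "\<dots> \<le> \<bar>t\<bar> * bs n * (D / sqrt (real n))"
        proof (intro mult_left_mono)
          have "D / sqrt (real n + 1) \<le> D / sqrt (real n)"
            using D(1) n by (intro divide_left_mono) auto
          then show "\<bar>w n k\<bar> \<le> D / sqrt (real n)" using D(2)[of k n] that by linarith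
        qed (use bpos in auto)
        finally show ?thesis by (simp add: q_def mult_ac)
      qed
      have sum_sq: "(\<Sum>k<Suc n. (t * a n / bs n * w n k)\<^sup>2) = t\<^sup>2 * a n"
      proof -
        have "(\<Sum>k<Suc n. (t * a n / bs n * w n k)\<^sup>2) = (t * a n / bs n)\<^sup>2 * (\<Sum>k<Suc n. (w n k)\<^sup>2)"
          by (simp only: power_mult_distrib sum_distrib_left)
        also have "\<dots> = t\<^sup>2 * a n"
          unfolding w_sq using bpos by (simp add: a_def power2_eq_square)
        finally show ?thesis .
      qed
      have lo: "exp (exp (- (q n * K\<^sub>u + (q n)\<^sup>2 * \<sigma>\<^sup>2 / 2)) * (\<sigma>\<^sup>2 / 2) * (t\<^sup>2 * a n)) \<le> G t n"
        unfolding G_def exp_Y sum_sq[symmetric]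
        by (rule exp_martingale_sum_ge[OF md bdd var s2 K]) (rule small)
      have hi: "G t n \<le> exp (exp (q n * K\<^sub>u) * (\<sigma>\<^sup>2 / 2) * (t\<^sup>2 * a n))"
        unfolding G_def exp_Y sum_sq[symmetric]
        by (rule exp_martingale_sum_le[OF md bdd var s2 K]) (rule small)
      have Gpos: "0 < G t n" using lo exp_gt_zero less_le_trans by blast
      have "exp (- (q n * K\<^sub>u + (q n)\<^sup>2 * \<sigma>\<^sup>2 / 2)) * (\<sigma>\<^sup>2 / 2) * (t\<^sup>2 * a n) \<le> ln (G t n)"
        using lo by (simp only: ln_ge_iff[OF Gpos])
      moreover have "ln (G t n) \<le> exp (q n * K\<^sub>u) * (\<sigma>\<^sup>2 / 2) * (t\<^sup>2 * a n)"
        using hi Gpos by (metis exp_gt_zero ln_exp ln_le_cancel_iff)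
      ultimately show ?thesis
        using apos by (simp add: pos_le_divide_eq pos_divide_le_eq mult_ac)
    qed
    show ?thesis
    proof (rule tendsto_sandwich)
      show "\<forall>\<^sub>F n in sequentially. exp (- (q n * K\<^sub>u + (q n)\<^sup>2 * \<sigma>\<^sup>2 / 2)) * (t\<^sup>2 * \<sigma>\<^sup>2 / 2) \<le> ln (G t n) / a n"
        "\<forall>\<^sub>F n in sequentially. ln (G t n) / a n \<le> exp (q n * K\<^sub>u) * (t\<^sup>2 * \<sigma>\<^sup>2 / 2)"
        using bounds by (auto simp: eventually_sequentially)
      have "(\<lambda>n. exp (- (q n * K\<^sub>u + (q n)\<^sup>2 * \<sigma>\<^sup>2 / 2)) * (t\<^sup>2 * \<sigma>\<^sup>2 / 2))
          \<longlonglongrightarrow> exp (- (0 * K\<^sub>u + 0\<^sup>2 * \<sigma>\<^sup>2 / 2)) * (t\<^sup>2 * \<sigma>\<^sup>2 / 2)"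
        by (intro tendsto_intros q_lim) simp
      then show "(\<lambda>n. exp (- (q n * K\<^sub>u + (q n)\<^sup>2 * \<sigma>\<^sup>2 / 2)) * (t\<^sup>2 * \<sigma>\<^sup>2 / 2)) \<longlonglongrightarrow> t\<^sup>2 * \<sigma>\<^sup>2 / 2"
        by simp
      have "(\<lambda>n. exp (q n * K\<^sub>u) * (t\<^sup>2 * \<sigma>\<^sup>2 / 2)) \<longlonglongrightarrow> exp (0 * K\<^sub>u) * (t\<^sup>2 * \<sigma>\<^sup>2 / 2)"
        by (intro tendsto_intros q_lim)
      then show "(\<lambda>n. exp (q n * K\<^sub>u) * (t\<^sup>2 * \<sigma>\<^sup>2 / 2)) \<longlonglongrightarrow> t\<^sup>2 * \<sigma>\<^sup>2 / 2" by simp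
    qed
  qed
  have "(\<lambda>n. ln (prob {x \<in> space M. r < \<bar>Y n x\<bar>}) / a n) \<longlonglongrightarrow> - (r\<^sup>2 / (2 * \<sigma>\<^sup>2))"
    by (rule gaussian_gaertner_ellis[OF a_lim YM int mgf[unfolded G_def] _ assms(11)]) (use assms(4) in simp)
  moreover have "\<forall>\<^sub>F n in sequentially. ln (prob {x \<in> space M. r < \<bar>Y n x\<bar>}) / a n =
      1 / (bs n)\<^sup>2 * ln (measure M {x \<in> space M.
        h_norm b \<alpha>\<^sub>1 n *
          \<bar>b * (\<Sum>k=0..n. 1 / (real k + 1) * beta_prod (b * \<alpha>\<^sub>1) (k + 1) n * U (k + 1) x)\<bar>
        > r * bs n})"
    using eventually_ge_at_top[of 1]
  proof eventually_elim
    case (elim n)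
    have bpos: "0 < bs n" using assms(7) elim by simp
    have event: "r < \<bar>Y n x\<bar> \<longleftrightarrow> h_norm b \<alpha>\<^sub>1 n *
          \<bar>b * (\<Sum>k=0..n. 1 / (real k + 1) * beta_prod (b * \<alpha>\<^sub>1) (k + 1) n * U (k + 1) x)\<bar> > r * bs n"
      (is "_ \<longleftrightarrow> ?h * \<bar>?Q\<bar> > _") for x
    proof -
      have h: "0 \<le> ?h" by (simp add: h_norm_def)
      have "Y n x * bs n = ?h * ?Q"
        unfolding Y_def w_def normed_weight_def weight_def sum_distrib_left lessThan_Suc_atMost atLeast0AtMost
        using bpos by (simp add: mult.assoc)
      then have eq: "\<bar>Y n x\<bar> * bs n = ?h * \<bar>?Q\<bar>"
        using abs_mult[of "Y n x" "bs n"] abs_mult[of ?h ?Q] abs_of_pos[OF bpos] abs_of_nonneg[OF h]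
        by (simp only:)
      have "r < \<bar>Y n x\<bar> \<longleftrightarrow> r * bs n < \<bar>Y n x\<bar> * bs n" using bpos by simp
      then show ?thesis by (simp only: eq)
    qed
    show ?case by (simp only: event a_def times_divide_eq_left mult_1)
  qed
  ultimately show ?thesis by (rule Lim_transform_eventually)
qed

end
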